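(* Let $K$ be an algebraically closed field, let $V$ be a $K$-vector space, and let $A=(V,\bullet)$ and $B=(V,\circ)$ be two associative algebra structures on $V$, where $B$ is semisimple. Let $(V,\succ,\prec)$ be a post-associative algebra structure on the pair $(A,B)$. Then there is a Rota--Baxter operator $R\colon B\to B$ of weight $1$ such that $x\succ y=R(x)\circ y$ and $x\prec y=x\circ R(y)$ for all $x,y\in V$.
   Context: Algebras are finite-dimensional. A semisimple associative algebra is a (finite-dimensional) associative algebra with zero Jacobson radical; it is then unital and a direct sum of simple algebras. Given two associative products $A=(V,\bullet)$ and $B=(V,\circ)$ on the same $K$-vector space $V$, a post-associative algebra structure on the pair $(A,B)$ is a pair of $K$-bilinear products $\succ,\prec$ on $V$ such that for all $x,y,z\in V$: (1) $x\bullet y-x\circ y=x\succ y+x\prec y$; (2) $(x\bullet y)\succ z=x\succ(y\succ z)$; (3) $x\prec(y\bullet z)=(x\prec y)\prec z$; (4) $x\succ(y\circ z)=(x\succ y)\circ z$; (5) $(x\circ y)\prec z=x\circ(y\prec z)$; (6) $(x\prec y)\circ z=x\circ(y\succ z)$. A Rota--Baxter operator of weight $1$ on $B$ is a linear map $R\colon B\to B$ with $R(x)\circ R(y)=R\bigl(R(x)\circ y+x\circ R(y)+x\circ y\bigr)$ for all $x,y\in B$. *)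

theory Defs
  imports "HOL-Computational_Algebra.Polynomial"
begin

definition bilinear_product ::
    "('k::field \<Rightarrow> 'v::ab_group_add \<Rightarrow> 'v) \<Rightarrow> ('v \<Rightarrow> 'v \<Rightarrow> 'v) \<Rightarrow> bool" where
  "bilinear_product scale p \<longleftrightarrow>
     (\<forall>x. Vector_Spaces.linear scale scale (\<lambda>y. p x y)) \<and>
     (\<forall>y. Vector_Spaces.linear scale scale (\<lambda>x. p x y))"

text \<open>Finite-dimensional associative algebras, not assumed to be unital. The underlying vector
  space is the whole type \<^typ>\<open>'v\<close>.\<close>

locale associative_algebra = vector_space scale
  for scale :: "'k::field \<Rightarrow> 'v::ab_group_add \<Rightarrow> 'v" +
  fixes mult :: "'v \<Rightarrow> 'v \<Rightarrow> 'v"  (infixl "\<cdot>" 70)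
  assumes finite_dim: "\<exists>Basis. finite_dimensional_vector_space scale Basis"
    and bilinear_mult: "bilinear_product scale mult"
    and mult_assoc: "(x \<cdot> y) \<cdot> z = x \<cdot> (y \<cdot> z)"
begin

definition left_ideal :: "'v set \<Rightarrow> bool" where
  "left_ideal L \<longleftrightarrow> subspace L \<and> (\<forall>a. \<forall>x\<in>L. a \<cdot> x \<in> L)"

text \<open>In an algebra without unit the Jacobson radical is the intersection of the maximal
  \<^emph>\<open>modular\<close> left ideals; if there is a unit, every left ideal is modular. When there is
  no maximal modular left ideal (e.g. for zero multiplication) the radical is the whole algebra.\<close>

definition modular_left_ideal :: "'v set \<Rightarrow> bool" where
  "modular_left_ideal L \<longleftrightarrow> left_ideal L \<and> (\<exists>e. \<forall>x. x - x \<cdot> e \<in> L)"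

definition maximal_modular_left_ideal :: "'v set \<Rightarrow> bool" where
  "maximal_modular_left_ideal M \<longleftrightarrow>
     modular_left_ideal M \<and> M \<noteq> UNIV \<and>
     (\<forall>L. left_ideal L \<longrightarrow> M \<subseteq> L \<longrightarrow> L = M \<or> L = UNIV)"

definition jacobson_radical :: "'v set" where
  "jacobson_radical = \<Inter> {M. maximal_modular_left_ideal M}"

end

locale semisimple_algebra = associative_algebra scale mult
  for scale :: "'k::field \<Rightarrow> 'v::ab_group_add \<Rightarrow> 'v"
    and mult :: "'v \<Rightarrow> 'v \<Rightarrow> 'v" +
  assumes radical_zero: "jacobson_radical = {0}"

locale post_associative_structure =
  A: associative_algebra scale multA + B: associative_algebra scale multB
  for scale :: "'k::field \<Rightarrow> 'v::ab_group_add \<Rightarrow> 'v"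
    and multA :: "'v \<Rightarrow> 'v \<Rightarrow> 'v"  (infixl "\<cdot>\<^sub>A" 70)
    and multB :: "'v \<Rightarrow> 'v \<Rightarrow> 'v"  (infixl "\<cdot>\<^sub>B" 70) +
  fixes succ_prod :: "'v \<Rightarrow> 'v \<Rightarrow> 'v"  (infixl "\<succ>" 70)
    and prec_prod :: "'v \<Rightarrow> 'v \<Rightarrow> 'v"  (infixl "\<prec>" 70)
  assumes bilinear_succ: "bilinear_product scale succ_prod"
    and bilinear_prec: "bilinear_product scale prec_prod"
    and diff_eq: "x \<cdot>\<^sub>A y - x \<cdot>\<^sub>B y = x \<succ> y + x \<prec> y"
    and succ_multA: "(x \<cdot>\<^sub>A y) \<succ> z = x \<succ> (y \<succ> z)"
    and prec_multA: "x \<prec> (y \<cdot>\<^sub>A z) = (x \<prec> y) \<prec> z"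
    and succ_multB: "x \<succ> (y \<cdot>\<^sub>B z) = (x \<succ> y) \<cdot>\<^sub>B z"
    and multB_prec: "(x \<cdot>\<^sub>B y) \<prec> z = x \<cdot>\<^sub>B (y \<prec> z)"
    and prec_succ: "(x \<prec> y) \<cdot>\<^sub>B z = x \<cdot>\<^sub>B (y \<succ> z)"

definition (in associative_algebra) rota_baxter_weight_one :: "('v \<Rightarrow> 'v) \<Rightarrow> bool" where
  "rota_baxter_weight_one R \<longleftrightarrow>
     Vector_Spaces.linear scale scale R \<and>
     (\<forall>x y. R x \<cdot> R y = R (R x \<cdot> y + x \<cdot> R y + x \<cdot> y))"

end

theory Submission
  imports Defs
begin

text \<open>A semisimple algebra \<open>B\<close> has a unit \<open>u\<close>. The intersection of a modular left ideal
  with a maximal modular one is again modular, so a modular left ideal of least dimension lies in the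
  radical and is zero, which makes its modular element a right unit \<open>u\<close>. Any
  \<open>z\<close> with \<open>B \<cdot> z = 0\<close> lies in the radical, and \<open>x - u \<cdot> x\<close> is such an element, so \<open>u\<close> is also
  a left unit. Putting \<open>u\<close> into the module identities gives \<open>x \<succ> y = (x \<succ> u) \<cdot> y\<close>,
  \<open>x \<prec> y = x \<cdot> (u \<prec> y)\<close> and \<open>u \<prec> x = x \<succ> u\<close>, so \<open>R x = x \<succ> u\<close> works: the Rota--Baxter
  identity is \<open>(x \<bullet> y) \<succ> u = x \<succ> (y \<succ> u)\<close>, where \<open>\<bullet>\<close> is the product of \<open>A\<close>.\<close>

lemma bilinear_product_linear:
  assumes "bilinear_product scale p"
  shows "Vector_Spaces.linear scale scale (p x)"
    and "Vector_Spaces.linear scale scale (\<lambda>x. p x y)"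
  using assms unfolding bilinear_product_def by auto

context associative_algebra
begin

lemma linear_mult_right: "Vector_Spaces.linear scale scale (\<lambda>y. x \<cdot> y)"
  using bilinear_mult by (rule bilinear_product_linear)

lemma mult_add_right: "z \<cdot> (x + y) = z \<cdot> x + z \<cdot> y"
  using linear_mult_right by (simp add: Vector_Spaces.linear_iff)

lemma mult_diff_right: "z \<cdot> (x - y) = z \<cdot> x - z \<cdot> y"
  using mult_add_right[of z "x - y" y] by (simp add: eq_diff_eq)

lemma mult_scale_right: "z \<cdot> scale c x = scale c (z \<cdot> x)"
  using linear_mult_right by (simp add: Vector_Spaces.linear_iff)

lemma left_ideal_add:
  assumes "left_ideal I" "left_ideal J"
  shows "left_ideal {x + y | x y. x \<in> I \<and> y \<in> J}"
  unfolding left_ideal_def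
proof (intro conjI allI ballI)
  show "subspace {x + y | x y. x \<in> I \<and> y \<in> J}"
    using assms by (intro subspace_sums) (auto simp: left_ideal_def)
  fix a s assume "s \<in> {x + y | x y. x \<in> I \<and> y \<in> J}"
  then obtain x y where "x \<in> I" "y \<in> J" "a \<cdot> s = a \<cdot> x + a \<cdot> y"
    by (auto simp: mult_add_right)
  then show "a \<cdot> s \<in> {x + y | x y. x \<in> I \<and> y \<in> J}"
    using assms unfolding left_ideal_def by blast
qed

text \<open>The left ideal \<open>I + M\<close> contains \<open>M\<close> properly, so maximality
  makes it the whole algebra and every \<open>a\<close> splits.\<close>

lemma maximal_modular_left_ideal_sum:
  assumes M: "maximal_modular_left_ideal M" and I: "left_ideal I" and nsub: "\<not> I \<subseteq> M"
  obtains x y where "x \<in> I" "y \<in> M" "a = x + y"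
proof -
  define S where "S = {x + y | x y. x \<in> I \<and> y \<in> M}"
  have lM: "left_ideal M" and sI: "subspace I" and sM: "subspace M"
    using M I by (auto simp: maximal_modular_left_ideal_def modular_left_ideal_def left_ideal_def)
  have "left_ideal S"
    unfolding S_def using I lM by (rule left_ideal_add)
  moreover have "M \<subseteq> S"
    unfolding S_def using subspace_0[OF sI] by force
  moreover have "I \<subseteq> S"
    unfolding S_def using subspace_0[OF sM] by force
  ultimately have "S = UNIV"
    using M nsub unfolding maximal_modular_left_ideal_def by blast
  then show thesis
    using that unfolding S_def by blast
qed

lemma modular_left_ideal_Int:
  assumes I: "modular_left_ideal I" and M: "maximal_modular_left_ideal M" and nsub: "\<not> I \<subseteq> M"
  shows "modular_left_ideal (I \<inter> M)"
proof -
  from I obtain e where e: "\<And>x. x - x \<cdot> e \<in> I" and lI: "left_ideal I"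
    unfolding modular_left_ideal_def by blast
  from M obtain f where f: "\<And>x. x - x \<cdot> f \<in> M" and lM: "left_ideal M"
    unfolding maximal_modular_left_ideal_def modular_left_ideal_def by blast
  have sub: "subspace I" "subspace M"
    using lI lM by (auto simp: left_ideal_def)
  obtain i m where im: "i \<in> I" "m \<in> M" "e - f = i + m"
    using maximal_modular_left_ideal_sum[OF M lI nsub] by metis
  \<comment> \<open>Chinese remainder: \<open>e - i\<close> is congruent to \<open>e\<close> modulo \<open>I\<close> and to \<open>f\<close> modulo \<open>M\<close>.\<close>
  have "x - x \<cdot> (e - i) \<in> I \<inter> M" for x
  proof
    have "x - x \<cdot> (e - i) = (x - x \<cdot> e) + x \<cdot> i"
      by (simp add: mult_diff_right)
    also have "\<dots> \<in> I"
      using e lI im sub by (auto simp: left_ideal_def intro: subspace_add)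
    finally show "x - x \<cdot> (e - i) \<in> I" .
    have "e - i = f + m"
      using im(3) by (simp add: algebra_simps)
    then have "x - x \<cdot> (e - i) = (x - x \<cdot> f) - x \<cdot> m"
      by (simp add: mult_add_right)
    also have "\<dots> \<in> M"
      using f lM im sub by (auto simp: left_ideal_def intro: subspace_diff)
    finally show "x - x \<cdot> (e - i) \<in> M" .
  qed
  moreover have "left_ideal (I \<inter> M)"
    using lI lM subspace_inter by (auto simp: left_ideal_def)
  ultimately show ?thesis
    unfolding modular_left_ideal_def by blast
qed

lemma modular_left_ideal_le_radical:
  obtains I where "modular_left_ideal I" "I \<subseteq> jacobson_radical"
proof -
  obtain Basis where "finite_dimensional_vector_space scale Basis"
    using finite_dim by blast
  then interpret fd: finite_dimensional_vector_space scale Basis .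
  \<comment> \<open>Any element serves as \<open>e\<close> here, so modular left ideals exist and
    one of least dimension can be chosen.\<close>
  have "modular_left_ideal UNIV"
    by (simp add: modular_left_ideal_def left_ideal_def)
  then obtain I where I: "modular_left_ideal I"
    and least: "\<And>J. modular_left_ideal J \<Longrightarrow> dim I \<le> dim J"
    using ex_has_least_nat[of modular_left_ideal UNIV dim] by blast
  have "I \<subseteq> M" if M: "maximal_modular_left_ideal M" for M
  proof (rule ccontr)
    assume nsub: "\<not> I \<subseteq> M"
    have IM: "modular_left_ideal (I \<inter> M)"
      using I M nsub by (rule modular_left_ideal_Int)
    have "subspace I" "subspace (I \<inter> M)"
      using I IM by (auto simp: modular_left_ideal_def left_ideal_def)
    \<comment> \<open>Both subspaces equal their spans; spans are the form that
      \<open>dim_psubset\<close> compares.\<close>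
    then have "span (I \<inter> M) \<subset> span I"
      using nsub by (auto simp: span_eq_iff[THEN iffD2])
    then have "dim (I \<inter> M) < dim I"
      by (rule fd.dim_psubset)
    then show False
      using least[OF IM] by simp
  qed
  then show thesis
    using I that unfolding jacobson_radical_def by blast
qed

text \<open>If \<open>M\<close> misses \<open>z\<close>, the modular element \<open>f\<close> of
  \<open>M\<close> splits as \<open>y + m\<close> with \<open>y\<close> in the line through
  \<open>z\<close>. Since \<open>y\<close> is killed from the left,
  \<open>x \<cdot> f = x \<cdot> m\<close> lies in \<open>M\<close>, hence so does every
  \<open>x\<close>, and \<open>M\<close> is not proper.\<close>

lemma right_annihilator_le_radical:
  assumes z: "\<And>a. a \<cdot> z = 0"
  shows "z \<in> jacobson_radical"
  unfolding jacobson_radical_def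
proof (intro InterI, clarify, rule ccontr)
  fix M assume M: "maximal_modular_left_ideal M" and zM: "z \<notin> M"
  from M obtain f where f: "\<And>x. x - x \<cdot> f \<in> M" and lM: "left_ideal M"
    unfolding maximal_modular_left_ideal_def modular_left_ideal_def by blast
  have annihilated: "x \<cdot> y = 0" if "y \<in> span {z}" for x y
    using that by (auto simp: span_singleton mult_scale_right z)
  then have "left_ideal (span {z})"
    by (simp add: left_ideal_def span_zero)
  moreover have "\<not> span {z} \<subseteq> M"
    using zM span_base[of z "{z}"] by auto
  ultimately obtain y m where y: "y \<in> span {z}" and m: "m \<in> M" and fym: "f = y + m"
    using maximal_modular_left_ideal_sum[OF M] by metis
  have "x \<in> M" for x
  proof -
    have "x \<cdot> f \<in> M"
      using m lM by (simp add: fym mult_add_right annihilated[OF y] left_ideal_def)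
    then have "(x - x \<cdot> f) + x \<cdot> f \<in> M"
      using f lM subspace_add unfolding left_ideal_def by blast
    then show ?thesis by simp
  qed
  then show False
    using M by (auto simp: maximal_modular_left_ideal_def)
qed

end

lemma (in semisimple_algebra) unit_exists:
  obtains u where "\<And>x. mult u x = x" "\<And>x. mult x u = x"
proof -
  obtain I where "modular_left_ideal I" "I \<subseteq> jacobson_radical"
    by (rule modular_left_ideal_le_radical)
  then obtain u where "\<And>x. x - mult x u \<in> {0}"
    using radical_zero unfolding modular_left_ideal_def by blast
  then have right: "mult x u = x" for x
    by (metis eq_iff_diff_eq_0 singletonD)
  have "x - mult u x \<in> jacobson_radical" for x
  proof (rule right_annihilator_le_radical)
    \<comment> \<open>By associativity \<open>a(ux) = (au)x\<close>, which is \<open>ax\<close>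
      because \<open>u\<close> is a right unit.\<close>
    show "mult a (x - mult u x) = 0" for a
      by (simp add: mult_diff_right right flip: mult_assoc)
  qed
  then have "mult u x = x" for x
    using radical_zero by auto
  with right show thesis
    using that by blast
qed

lemma (in post_associative_structure) rota_baxter_of_unit:
  assumes left: "\<And>x. u \<cdot>\<^sub>B x = x" and right: "\<And>x. x \<cdot>\<^sub>B u = x"
  shows "B.rota_baxter_weight_one (\<lambda>x. x \<succ> u)"
    and "x \<succ> y = (x \<succ> u) \<cdot>\<^sub>B y"
    and "x \<prec> y = x \<cdot>\<^sub>B (y \<succ> u)"
proof -
  have succ: "x \<succ> y = (x \<succ> u) \<cdot>\<^sub>B y" for x y
    using succ_multB[of x u y] by (simp add: left)
  \<comment> \<open>With \<open>u\<close> in both outer places, \<open>prec_succ\<close> identifies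
    the operators coming from the two products.\<close>
  have R: "u \<prec> y = y \<succ> u" for y
    using prec_succ[of u y u] by (simp add: left right)
  have prec: "x \<prec> y = x \<cdot>\<^sub>B (y \<succ> u)" for x y
    using multB_prec[of x u y] by (simp add: right R)
  show "x \<succ> y = (x \<succ> u) \<cdot>\<^sub>B y" "x \<prec> y = x \<cdot>\<^sub>B (y \<succ> u)"
    by (fact succ prec)+
  have "(x \<succ> u) \<cdot>\<^sub>B (y \<succ> u) = ((x \<succ> u) \<cdot>\<^sub>B y + x \<cdot>\<^sub>B (y \<succ> u) + x \<cdot>\<^sub>B y) \<succ> u" for x y
  proof -
    \<comment> \<open>Taking \<open>y \<succ> u\<close> as second argument of \<open>succ\<close>
      turns the left side into \<open>x \<succ> (y \<succ> u)\<close>.\<close>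
    have "(x \<succ> u) \<cdot>\<^sub>B (y \<succ> u) = (x \<cdot>\<^sub>A y) \<succ> u"
      by (simp only: succ_multA succ[of x "y \<succ> u"])
    moreover have "x \<cdot>\<^sub>A y = x \<succ> y + x \<prec> y + x \<cdot>\<^sub>B y"
      using diff_eq[of x y] by (simp add: diff_eq_eq)
    ultimately show ?thesis
      by (simp only: succ[of x y] prec[of x y])
  qed
  then show "B.rota_baxter_weight_one (\<lambda>x. x \<succ> u)"
    using bilinear_product_linear(2)[OF bilinear_succ]
    unfolding B.rota_baxter_weight_one_def by blast
qed

theorem theorem3p1:
  fixes scale :: "'k::alg_closed_field \<Rightarrow> 'v::ab_group_add \<Rightarrow> 'v"
    and multA multB succ_prod prec_prod :: "'v \<Rightarrow> 'v \<Rightarrow> 'v"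
  assumes "vector_space scale"
    and "associative_algebra scale multA"
    and "semisimple_algebra scale multB"
    and "post_associative_structure scale multA multB succ_prod prec_prod"
  shows "\<exists>R. associative_algebra.rota_baxter_weight_one scale multB R \<and>
             (\<forall>x y. succ_prod x y = multB (R x) y \<and> prec_prod x y = multB x (R y))"
proof -
  obtain u where "\<And>x. multB u x = x" "\<And>x. multB x u = x"
    using semisimple_algebra.unit_exists[OF assms(3)] by blast
  from post_associative_structure.rota_baxter_of_unit[OF assms(4) this] show ?thesis
    by blast
qed

end
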